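(* Let $\mathbb{F}$ be a field with more than $d$ elements. Let $f\in \mathbb{F}\langle z_1, z_2, \ldots, z_n\rangle$ be a nonzero polynomial of degree $d$ with exactly $t$ nonzero monomials. Then $f$ is not a polynomial identity for the matrix ring $\mathbb{M}_k(\mathbb{F})$, where $k=\lceil \log_2 t\rceil + 1$; that is, there exist matrices $A_1,\ldots,A_n\in\mathbb{M}_k(\mathbb{F})$ with $f(A_1,\ldots,A_n)\neq 0$.
   Context: $\mathbb{F}\langle z_1,\ldots,z_n\rangle$ denotes the free noncommutative polynomial ring over $\mathbb{F}$ in the noncommuting variables $z_1,\ldots,z_n$: its monomials are the finite words over the alphabet $\{z_1,\ldots,z_n\}$, and a polynomial is a finite $\mathbb{F}$-linear combination of monomials; the degree of a monomial is its length, and the degree of $f$ is the maximum degree of a monomial with nonzero coefficient. $\mathbb{M}_k(\mathbb{F})$ is the ring of $k\times k$ matrices over $\mathbb{F}$. A polynomial $f$ is a polynomial identity for $\mathbb{M}_k(\mathbb{F})$ if $f(A_1,\ldots,A_n)=0$ for all $A_1,\ldots,A_n\in\mathbb{M}_k(\mathbb{F})$. *)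

theory Defs
  imports Complex_Main "HOL-Library.Poly_Mapping" "Jordan_Normal_Form.Matrix"
begin

text \<open>
  Words form the free monoid under concatenation, written additively here so that the
  convolution product of \<^theory>\<open>HOL-Library.Poly_Mapping\<close> makes
  \<^typ>\<open>nat list \<Rightarrow>\<^sub>0 'a\<close> the free noncommutative polynomial ring on countably many
  variables; the letter \<^term>\<open>i::nat\<close> stands for $z_{i+1}$.
\<close>

instantiation list :: (type) monoid_add
begin

definition zero_list :: "'a list" where "zero_list = []"

definition plus_list :: "'a list \<Rightarrow> 'a list \<Rightarrow> 'a list" where "plus_list u v = u @ v"

instance by standard (simp_all add: zero_list_def plus_list_def)

end

type_synonym 'a nc_poly = "nat list \<Rightarrow>\<^sub>0 'a"

definition nc_polys :: "nat \<Rightarrow> 'a::zero nc_poly set" where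
  "nc_polys n = {f. \<forall>w \<in> Poly_Mapping.keys f. set w \<subseteq> {..<n}}"

text \<open>Only meaningful for nonzero polynomials.\<close>

definition nc_degree :: "'a::zero nc_poly \<Rightarrow> nat" where
  "nc_degree f = Max (length ` Poly_Mapping.keys f)"

definition word_eval :: "nat \<Rightarrow> (nat \<Rightarrow> 'a::semiring_1 mat) \<Rightarrow> nat list \<Rightarrow> 'a mat" where
  "word_eval k A w = foldr (\<lambda>i M. A i * M) w (1\<^sub>m k)"

definition nc_eval :: "nat \<Rightarrow> (nat \<Rightarrow> 'a::comm_ring_1 mat) \<Rightarrow> 'a nc_poly \<Rightarrow> 'a mat" where
  "nc_eval k A f = finsum (ring_mat TYPE('a) k ())
     (\<lambda>w. Poly_Mapping.lookup f w \<cdot>\<^sub>m word_eval k A w) (Poly_Mapping.keys f)"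

definition polynomial_identity :: "nat \<Rightarrow> nat \<Rightarrow> 'a::comm_ring_1 nc_poly \<Rightarrow> bool" where
  "polynomial_identity n k f \<longleftrightarrow>
     (\<forall>A. (\<forall>i<n. A i \<in> carrier_mat k k) \<longrightarrow> nc_eval k A f = 0\<^sub>m k k)"

lemma word_eval_carrier:
  assumes "\<And>i. i \<in> set w \<Longrightarrow> A i \<in> carrier_mat k k"
  shows "word_eval k A w \<in> carrier_mat k k"
  using assms by (induction w) (auto simp: word_eval_def intro!: mult_carrier_mat)

lemma nc_eval_carrier_index:
  fixes f :: "'a::comm_ring_1 nc_poly"
  assumes f: "f \<in> nc_polys n" and A: "\<And>i. i < n \<Longrightarrow> A i \<in> carrier_mat k k"
  shows nc_eval_carrier: "nc_eval k A f \<in> carrier_mat k k"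
    and nc_eval_index: "r < k \<Longrightarrow> c < k \<Longrightarrow> nc_eval k A f $$ (r, c) =
      (\<Sum>w\<in>Poly_Mapping.keys f. Poly_Mapping.lookup f w * word_eval k A w $$ (r, c))"
proof -
  let ?R = "ring_mat TYPE('a) k ()"
  let ?g = "\<lambda>w. Poly_Mapping.lookup f w \<cdot>\<^sub>m word_eval k A w"
  interpret ring ?R by (rule ring_mat)
  have W: "word_eval k A w \<in> carrier_mat k k" if "w \<in> Poly_Mapping.keys f" for w
    using f A that by (intro word_eval_carrier) (auto simp: nc_polys_def)
  have g: "?g w \<in> carrier_mat k k" if "w \<in> Poly_Mapping.keys f" for w
    using W[OF that] by simp
  have main: "finsum ?R ?g S \<in> carrier_mat k k \<and>
    (\<forall>r<k. \<forall>c<k. finsum ?R ?g S $$ (r, c) =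
      (\<Sum>w\<in>S. Poly_Mapping.lookup f w * word_eval k A w $$ (r, c)))"
    if "finite S" "S \<subseteq> Poly_Mapping.keys f" for S
    using that
  proof (induction S rule: finite_induct)
    case empty
    then show ?case by (simp add: ring_mat_simps)
  next
    case (insert w S)
    have eq: "finsum ?R ?g (insert w S) = ?g w + finsum ?R ?g S"
      using insert g by (subst finsum_insert) (auto simp: ring_mat_simps)
    have "word_eval k A w \<in> carrier_mat k k" using W insert.prems by simp
    with insert show ?case unfolding eq by auto
  qed
  show "nc_eval k A f \<in> carrier_mat k k"
    using main[of "Poly_Mapping.keys f"] by (simp add: nc_eval_def)
  show "r < k \<Longrightarrow> c < k \<Longrightarrow> nc_eval k A f $$ (r, c) =
      (\<Sum>w\<in>Poly_Mapping.keys f. Poly_Mapping.lookup f w * word_eval k A w $$ (r, c))"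
    using main[of "Poly_Mapping.keys f"] by (simp add: nc_eval_def)
qed

end

theory Submission
  imports Defs "HOL-Computational_Algebra.Polynomial"
begin

text \<open>
  Substitute for $z_{i+1}$ the lower bidiagonal matrix with diagonal entries $\xi_p$ and with
  $(p, p-1)$ entry $[i = a_p]$. The $(m,0)$ entry of the value of a word $w$ is then the sum, over
  all factorizations $w = u_m a_m u_{m-1} a_{m-1} \cdots a_1 u_0$, of the products of the
  $\xi_p^{|u_p|}$. The coefficient of $\prod_p \xi_p^{e_p}$ in the $(m,0)$ entry of the value of $f$
  is therefore the sum of the coefficients of those monomials of $f$ that match the pattern $(e,a)$.
  Reading the monomials from left to right and, at each branching, following a letter
  that at most half of the remaining words carry, one finds a pattern with at most $\log_2 t$
  letters matched by exactly one monomial. As each $\xi_p$ has degree at most $d$, the field is large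
  enough to choose the $\xi_p$ one after the other such that the entry does not vanish.
\<close>

text \<open>Indices descend because a run through the matrix product goes from row m down to column
  0. Here \<open>e p\<close> is the length of the block u_p, and \<open>a p\<close> is the letter
  read between u_p and u_{p-1}. The last block must exhaust the word.\<close>

primrec matches :: "(nat \<Rightarrow> nat) \<Rightarrow> (nat \<Rightarrow> 'b) \<Rightarrow> nat \<Rightarrow> 'b list \<Rightarrow> bool" where
  "matches e a 0 w \<longleftrightarrow> length w = e 0"
| "matches e a (Suc m) w \<longleftrightarrow>
     e (Suc m) < length w \<and> w ! e (Suc m) = a (Suc m) \<and> matches e a m (drop (Suc (e (Suc m))) w)"

text \<open>This is the generating function of the patterns that match w: the index i is the length
  of the leading block.\<close>

primrec path_weight :: "(nat \<Rightarrow> 'a::comm_ring_1) \<Rightarrow> (nat \<Rightarrow> 'b) \<Rightarrow> nat \<Rightarrow> 'b list \<Rightarrow> 'a" where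
  "path_weight \<xi> a 0 w = \<xi> 0 ^ length w"
| "path_weight \<xi> a (Suc m) w = (\<Sum>i<length w.
     if w ! i = a (Suc m) then \<xi> (Suc m) ^ i * path_weight \<xi> a m (drop (Suc i) w) else 0)"

lemma matches_cong:
  assumes "\<And>j. j \<le> m \<Longrightarrow> e j = e' j" "\<And>j. j \<le> m \<Longrightarrow> a j = a' j"
  shows "matches e a m w = matches e' a' m w"
  using assms by (induction m arbitrary: w) auto

lemma path_weight_cong:
  assumes "\<And>j. j \<le> m \<Longrightarrow> \<xi> j = \<xi>' j"
  shows "path_weight \<xi> a m w = path_weight \<xi>' a m w"
  using assms by (induction m arbitrary: w) (auto intro!: sum.cong)

text \<open>The term i = 0 reads x as the pattern letter; in all others x belongs to the leading
  block and contributes one factor \<open>\<xi> (Suc m)\<close>.\<close>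

lemma path_weight_Suc_Cons:
  "path_weight \<xi> a (Suc m) (x # w) =
    \<xi> (Suc m) * path_weight \<xi> a (Suc m) w + (if x = a (Suc m) then path_weight \<xi> a m w else 0)"
  by (simp add: sum.lessThan_Suc_shift sum_distrib_left if_distrib mult.assoc add.commute
      cong: if_cong del: sum.lessThan_Suc)

text \<open>Any letter put in front is absorbed by the leading block, at no cost in pattern
  letters.\<close>

lemma matches_shift:
  "matches (e(m := Suc (e m))) a m (x # w) \<longleftrightarrow> matches e a m w"
proof (cases m)
  case (Suc m')
  have "matches (e(m := Suc (e m))) a m' v = matches e a m' v" for v
    by (rule matches_cong) (auto simp: Suc)
  then show ?thesis by (simp add: Suc)
qed simp

text \<open>An empty new leading block forces the first letter of the word to be compared with
  x.\<close>

lemma matches_branch: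
  "matches (e(Suc m := 0)) (a(Suc m := x)) (Suc m) (y # w) \<longleftrightarrow> y = x \<and> matches e a m w"
proof -
  have "matches (e(Suc m := 0)) (a(Suc m := x)) m w = matches e a m w"
    by (rule matches_cong) auto
  then show ?thesis by simp
qed

text \<open>Induction on the length bound. The empty word is isolated by a single block of length 0;
  a first letter common to all words is absorbed into the leading block; otherwise one pattern
  letter is spent and the set shrinks to at most half.\<close>

lemma exists_isolating_pattern:
  fixes S :: "'b list set"
  assumes "finite S" "S \<noteq> {}" "\<forall>w\<in>S. length w \<le> N"
  shows "\<exists>m e a u. 2 ^ m \<le> card S \<and> u \<in> S \<and> (\<forall>w\<in>S. matches e a m w \<longleftrightarrow> w = u)"
  using assms
proof (induction N arbitrary: S)
  case 0
  then have "S = {[]}" by auto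
  then show ?case
    by (intro exI[of _ 0] exI[of _ "\<lambda>_. 0"] exI[of _ "\<lambda>_. undefined"] exI[of _ "[]"]) simp
next
  case (Suc N)
  define tails where "tails x = {w. x # w \<in> S}" for x
  have img: "Cons x ` tails x = {w \<in> S. w \<noteq> [] \<and> hd w = x}" for x
    unfolding tails_def by (force simp: neq_Nil_conv)
  have fin: "finite (tails x)" for x
    using finite_imageD[of "Cons x" "tails x"] Suc.prems(1) by (simp add: img)
  have crd: "card (tails x) = card {w \<in> S. w \<noteq> [] \<and> hd w = x}" for x
    using card_image[of "Cons x" "tails x"] by (simp add: img)
  have ih: "\<exists>m e a u. 2 ^ m \<le> card (tails x) \<and> u \<in> tails x \<and>
      (\<forall>w\<in>tails x. matches e a m w \<longleftrightarrow> w = u)" if "tails x \<noteq> {}" for x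
    using Suc.prems(3) that by (intro Suc.IH fin) (auto simp: tails_def)
  consider (nil) "[] \<in> S"
    | (same) x where "\<forall>w\<in>S. \<exists>v. w = x # v"
    | (branch) x y v v' where "[] \<notin> S" "x \<noteq> y" "x # v \<in> S" "y # v' \<in> S"
    using Suc.prems(2) by (metis neq_Nil_conv equals0I)
  then show ?case
  proof cases
    case nil
    have "card S \<ge> 1" using Suc.prems by (simp add: Suc_le_eq card_gt_0_iff)
    with nil show ?thesis
      by (intro exI[of _ 0] exI[of _ "\<lambda>_. 0"] exI[of _ "\<lambda>_. undefined"] exI[of _ "[]"]) simp
  next
    case same
    then have "tails x \<noteq> {}" and S: "S = Cons x ` tails x"
      using Suc.prems(2) by (auto simp: tails_def)
    from ih[OF this(1)] obtain m e a u where *: "2 ^ m \<le> card (tails x)" "u \<in> tails x"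
      "\<forall>w\<in>tails x. matches e a m w \<longleftrightarrow> w = u" by blast
    have "card S = card (tails x)" unfolding S by (simp add: card_image)
    then have "2 ^ m \<le> card S" "x # u \<in> S" using *(1,2) S by auto
    moreover have "matches (e(m := Suc (e m))) a m w \<longleftrightarrow> w = x # u" if "w \<in> S" for w
    proof -
      obtain v where w: "w = x # v" "v \<in> tails x" using \<open>w \<in> S\<close> S by blast
      show ?thesis using *(3) w(2) unfolding w(1) matches_shift by blast
    qed
    ultimately show ?thesis by blast
  next
    case branch
    have "card (tails x) + card (tails y) =
        card ({w \<in> S. w \<noteq> [] \<and> hd w = x} \<union> {w \<in> S. w \<noteq> [] \<and> hd w = y})"
      unfolding crd using Suc.prems(1) branch(2) by (subst card_Un_disjoint) auto
    also have "\<dots> \<le> card S" using Suc.prems(1) by (intro card_mono) auto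
    \<comment> \<open>The words beginning with x and those beginning with y are disjoint, so one of
      the two classes has at most half of S.\<close>
    finally have "2 * card (tails x) \<le> card S \<or> 2 * card (tails y) \<le> card S" by linarith
    then obtain z where z: "2 * card (tails z) \<le> card S" "tails z \<noteq> {}"
      using branch unfolding tails_def by blast
    from ih[OF z(2)] obtain m e a u where *: "2 ^ m \<le> card (tails z)" "u \<in> tails z"
      "\<forall>w\<in>tails z. matches e a m w \<longleftrightarrow> w = u" by blast
    have "matches (e(Suc m := 0)) (a(Suc m := z)) (Suc m) w \<longleftrightarrow> w = z # u" if "w \<in> S" for w
    proof -
      obtain y' v where w: "w = y' # v" using \<open>w \<in> S\<close> branch(1) by (cases w) auto
      show ?thesis using *(3) \<open>w \<in> S\<close> unfolding w matches_branch by (auto simp: tails_def)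
    qed
    moreover have "2 ^ Suc m \<le> card S" using *(1) z(1) by simp
    moreover have "z # u \<in> S" using *(2) by (simp add: tails_def)
    ultimately show ?thesis by blast
  qed
qed

text \<open>A nonzero polynomial of degree at most d has at most d roots. The infinite case is
  separate because \<open>card\<close> is then 0.\<close>

lemma exists_nonroot:
  fixes b :: "nat \<Rightarrow> 'a::idom"
  assumes "infinite (UNIV :: 'a set) \<or> d < card (UNIV :: 'a set)"
    and "e \<le> d" "b e \<noteq> 0"
  shows "\<exists>x. (\<Sum>i\<le>d. x ^ i * b i) \<noteq> 0"
proof (rule ccontr)
  define p where "p = (\<Sum>i\<le>d. monom (b i) i)"
  assume "\<not> ?thesis"
  then have "{x. poly p x = 0} = UNIV"
    by (simp add: p_def poly_sum poly_monom mult.commute)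
  moreover have "coeff p e = b e"
    using assms(2) by (simp add: p_def coeff_sum)
  then have "p \<noteq> 0" using assms(3) by auto
  moreover have "degree p \<le> d"
    unfolding p_def by (intro degree_sum_le) (auto intro: order_trans[OF degree_monom_le])
  ultimately show False
    using assms(1) poly_roots_finite[of p] card_poly_roots_bound[of p] by auto
qed

text \<open>The values are chosen in the order \<open>\<xi> 0\<close>, \<open>\<xi> 1\<close>, and
  so on. The words form an indexed family because distinct words can have the same suffix once a
  prefix is dropped, yet must keep separate coefficients.\<close>

lemma exists_path_weight_sum_nonzero:
  fixes c :: "'s \<Rightarrow> 'a::idom" and v :: "'s \<Rightarrow> 'b list"
  assumes "infinite (UNIV :: 'a set) \<or> d < card (UNIV :: 'a set)"
    and "finite S" "\<forall>s\<in>S. length (v s) \<le> d"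
    and "(\<Sum>s\<in>{s\<in>S. matches e a m (v s)}. c s) \<noteq> 0"
  shows "\<exists>\<xi>. (\<Sum>s\<in>S. c s * path_weight \<xi> a m (v s)) \<noteq> 0"
  using assms(2-)
proof (induction m arbitrary: S v)
  case 0
  let ?b = "\<lambda>i. \<Sum>s\<in>{s\<in>S. length (v s) = i}. c s"
  have "e 0 \<le> d"
  proof (rule ccontr)
    assume "\<not> e 0 \<le> d"
    then have "{s\<in>S. matches e a 0 (v s)} = {}" using 0(2) by auto
    then show False using 0(3) by (metis sum.empty)
  qed
  then obtain x where x: "(\<Sum>i\<le>d. x ^ i * ?b i) \<noteq> 0"
    using exists_nonroot[of d "e 0" ?b] assms(1) 0(3) by auto
  have "(\<Sum>i\<le>d. x ^ i * ?b i) = (\<Sum>i\<le>d. \<Sum>s\<in>{s\<in>S. length (v s) = i}. c s * x ^ length (v s))"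
    by (auto simp: sum_distrib_left mult.commute intro!: sum.cong)
  also have "\<dots> = (\<Sum>s\<in>S. c s * x ^ length (v s))"
    using 0(1,2) by (intro sum.group) auto
  finally show ?case using x by (intro exI[of _ "\<lambda>_. x"]) simp
next
  case (Suc m)
  define S' where "S' i = {s\<in>S. i < length (v s) \<and> v s ! i = a (Suc m)}" for i
  let ?p = "e (Suc m)"
  have "{s\<in>S. matches e a (Suc m) (v s)} = {s\<in>S' ?p. matches e a m (drop (Suc ?p) (v s))}"
    by (auto simp: S'_def)
  then have ne: "(\<Sum>s\<in>{s\<in>S' ?p. matches e a m (drop (Suc ?p) (v s))}. c s) \<noteq> 0"
    using Suc.prems(3) by simp
  then obtain \<xi> where \<xi>: "(\<Sum>s\<in>S' ?p. c s * path_weight \<xi> a m (drop (Suc ?p) (v s))) \<noteq> 0"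
    using Suc.IH[of "S' ?p" "\<lambda>s. drop (Suc ?p) (v s)"] Suc.prems(1,2) by (force simp: S'_def)
  \<comment> \<open>The coefficient of the i-th power of \<open>\<xi> (Suc m)\<close>. It involves
    only \<open>\<xi> 0\<close> to \<open>\<xi> m\<close>, so \<open>\<xi> (Suc m)\<close> is still
    free; at i = \<open>?p\<close> it is nonzero by induction.\<close>
  define b where "b i = (\<Sum>s\<in>S' i. c s * path_weight \<xi> a m (drop (Suc i) (v s)))" for i
  have "S' ?p \<noteq> {}" using ne by auto
  then have "?p \<le> d" using Suc.prems(2) by (force simp: S'_def)
  then obtain x where x: "(\<Sum>i\<le>d. x ^ i * b i) \<noteq> 0"
    using exists_nonroot[of d ?p b] assms(1) \<xi> by (auto simp: b_def)
  let ?\<xi> = "\<xi>(Suc m := x)"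
  have cong: "path_weight ?\<xi> a m w = path_weight \<xi> a m w" for w
    by (rule path_weight_cong) auto
  \<comment> \<open>Padding the inner sums with zeros to the common range i \<le> d allows the two
    sums to be swapped.\<close>
  have "(\<Sum>s\<in>S. c s * path_weight ?\<xi> a (Suc m) (v s)) =
      (\<Sum>s\<in>S. \<Sum>i\<le>d. if i < length (v s) \<and> v s ! i = a (Suc m)
        then x ^ i * (c s * path_weight \<xi> a m (drop (Suc i) (v s))) else 0)"
    (is "?l = _")
  proof (rule sum.cong)
    fix s assume "s \<in> S"
    then have len: "length (v s) \<le> d" using Suc.prems(2) by auto
    show "c s * path_weight ?\<xi> a (Suc m) (v s) =
      (\<Sum>i\<le>d. if i < length (v s) \<and> v s ! i = a (Suc m)
        then x ^ i * (c s * path_weight \<xi> a m (drop (Suc i) (v s))) else 0)"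
      unfolding path_weight.simps cong sum_distrib_left
      using len by (intro sum.mono_neutral_cong_left) auto
  qed simp
  also have "\<dots> = (\<Sum>i\<le>d. x ^ i * b i)"
    unfolding b_def S'_def sum_distrib_left
    using Suc.prems(1) by (subst sum.swap) (simp add: sum.inter_filter)
  finally show ?case using x by metis
qed

text \<open>Transition matrix of a weighted automaton: on letter i, state p stays with weight
  \<open>\<xi> p\<close>, or moves down to p - 1 if i is \<open>a p\<close>.\<close>

definition bidiagonal :: "nat \<Rightarrow> (nat \<Rightarrow> 'a::comm_ring_1) \<Rightarrow> (nat \<Rightarrow> nat) \<Rightarrow> nat \<Rightarrow> 'a mat" where
  "bidiagonal k \<xi> a i =
     mat k k (\<lambda>(p, q). if p = q then \<xi> p else if p = Suc q \<and> i = a p then 1 else 0)"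

lemma bidiagonal_carrier [simp]: "bidiagonal k \<xi> a i \<in> carrier_mat k k"
  by (simp add: bidiagonal_def)

lemma bidiagonal_mult_index:
  assumes "M \<in> carrier_mat k k" "p < k" "q < k"
  shows "(bidiagonal k \<xi> a i * M) $$ (p, q) =
    \<xi> p * M $$ (p, q) + (if p > 0 \<and> i = a p then M $$ (p - 1, q) else 0)"
proof -
  have "(bidiagonal k \<xi> a i * M) $$ (p, q) =
      (\<Sum>j<k. (if p = j then \<xi> p else if p = Suc j \<and> i = a p then 1 else 0) * M $$ (j, q))"
    using assms by (simp add: bidiagonal_def scalar_prod_def lessThan_atLeast0)
  \<comment> \<open>For p = 0 the truncated p - 1 equals p; the guard p > 0 then removes the second
    term.\<close>
  also have "\<dots> = (\<Sum>j<k. (if j = p then \<xi> p * M $$ (p, q) else 0) +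
        (if j = p - 1 then if p > 0 \<and> i = a p then M $$ (p - 1, q) else 0 else 0))"
    by (intro sum.cong) auto
  also have "\<dots> = \<xi> p * M $$ (p, q) + (if p > 0 \<and> i = a p then M $$ (p - 1, q) else 0)"
    using assms less_imp_diff_less[of p k 1] by (simp add: sum.distrib)
  finally show ?thesis .
qed

text \<open>Multiplying by the matrix of the first letter gives the recursion of
  \<open>path_weight_Suc_Cons\<close>.\<close>

lemma word_eval_bidiagonal_index:
  assumes "m < k"
  shows "word_eval k (bidiagonal k \<xi> a) w $$ (m, 0) = path_weight \<xi> a m w"
  using assms
proof (induction w arbitrary: m)
  case Nil
  then show ?case by (cases m) (auto simp: word_eval_def)
next
  case (Cons x w)
  have "word_eval k (bidiagonal k \<xi> a) w \<in> carrier_mat k k"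
    by (rule word_eval_carrier) simp
  moreover have "word_eval k (bidiagonal k \<xi> a) (x # w) =
      bidiagonal k \<xi> a x * word_eval k (bidiagonal k \<xi> a) w"
    by (simp add: word_eval_def)
  ultimately show ?case
    using Cons by (cases m) (auto simp: bidiagonal_mult_index path_weight_Suc_Cons
        simp del: path_weight.simps(2))
qed

theorem theorem2:
  fixes f :: "'a::field nc_poly" and n d t k :: nat
  assumes "infinite (UNIV :: 'a set) \<or> d < card (UNIV :: 'a set)"
    and "f \<in> nc_polys n"
    and "f \<noteq> 0"
    and "nc_degree f = d"
    and "card (Poly_Mapping.keys f) = t"
    and "k = nat \<lceil>log 2 (real t)\<rceil> + 1"
  shows "\<not> polynomial_identity n k f"
proof
  assume pi: "polynomial_identity n k f"
  let ?S = "Poly_Mapping.keys f" and ?c = "Poly_Mapping.lookup f"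
  have len: "\<forall>w\<in>?S. length w \<le> d"
    using assms(4) by (auto simp: nc_degree_def)
  obtain m e a u where pat: "2 ^ m \<le> card ?S" "u \<in> ?S" "\<forall>w\<in>?S. matches e a m w \<longleftrightarrow> w = u"
    using exists_isolating_pattern[of ?S d] len assms(3) by auto
  \<comment> \<open>The sum over the matching words is thus the single coefficient of u, which is
    nonzero.\<close>
  have "{w\<in>?S. matches e a m w} = {u}" using pat by auto
  then have "(\<Sum>w\<in>{w\<in>?S. matches e a m w}. ?c w) \<noteq> 0"
    using pat(2) by (simp add: in_keys_iff)
  then obtain \<xi> where \<xi>: "(\<Sum>w\<in>?S. ?c w * path_weight \<xi> a m w) \<noteq> 0"
    using exists_path_weight_sum_nonzero[where v = "\<lambda>w. w", OF assms(1) finite_keys len] by blast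
  \<comment> \<open>Rows are numbered from 0, so the summand 1 in k makes m a valid row
    index.\<close>
  have "real m \<le> log 2 (real t)"
    using pat(1) assms(5) by (intro le_log2_of_power) simp
  then have "m < k" using assms(6) by linarith
  have "nc_eval k (bidiagonal k \<xi> a) f $$ (m, 0) =
      (\<Sum>w\<in>?S. ?c w * word_eval k (bidiagonal k \<xi> a) w $$ (m, 0))"
    using \<open>m < k\<close> by (intro nc_eval_index[OF assms(2)]) auto
  also have "\<dots> = (\<Sum>w\<in>?S. ?c w * path_weight \<xi> a m w)"
    using \<open>m < k\<close> by (simp only: word_eval_bidiagonal_index)
  finally have "nc_eval k (bidiagonal k \<xi> a) f $$ (m, 0) \<noteq> 0"
    using \<xi> by simp
  moreover have "nc_eval k (bidiagonal k \<xi> a) f = 0\<^sub>m k k"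
    using pi by (simp add: polynomial_identity_def)
  ultimately show False using \<open>m < k\<close> by simp
qed

end
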